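(* Let $(a,b)$ be a pair of coprime positive integers and let $n\ge 1$. Then $\Delta_{\mathrm{Dyck}_n}^{(a,b)}$ is a shellable simplicial complex. In particular, $\Delta_{\mathrm{Dyck}_n}=\Delta_{\mathrm{Dyck}_n}^{(1,1)}$ (which is isomorphic to $\Delta_{A_n}$ in the paper's notation) is a shellable simplicial complex.
   Context: For a word $w=w_1\cdots w_r$ in the alphabet $\{U,D\}$ and $0\le i\le r$ let $|U_i(w)|$ and $|D_i(w)|$ be the numbers of letters $U$ and $D$, respectively, among $w_1,\ldots,w_i$. For coprime positive integers $a,b$, the word $w$ is an $(a,b)$-Dyck path if $b\,|D_i(w)|\le a\,|U_i(w)|$ for $1\le i<r$ and $b\,|D_r(w)|=a\,|U_r(w)|$. Then $|U_r(w)|=nb$, $|D_r(w)|=na$ and $r=n(a+b)$ for an integer $n$, called the $(a,b)$-semilength of $w$. Let $\mathrm{Dyck}_n^{(a,b)}$ be the set of all $(a,b)$-Dyck paths of $(a,b)$-semilength $n$. A valley of $w$ is an index $1\le i<r$ with $w_i=D$, $w_{i+1}=U$; it is identified with its position $(i,\,|U_i(w)|-|D_i(w)|)\in\mathbb{Z}\times\mathbb{Z}$. Let $V(w)$ be the set of positions of all valleys of $w$ and set $\Delta_{\mathrm{Dyck}_n}^{(a,b)}=\{V(w) : w\in\mathrm{Dyck}_n^{(a,b)}\}$. A finite simplicial complex $\Delta$ (not necessarily pure) is shellable if there is a linear order $\prec$ on the set of its maximal (by inclusion) faces such that whenever $\sigma\prec\tau$ are maximal faces there is a maximal face $\gamma\prec\tau$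 with $\sigma\cap\tau\subseteq\gamma\cap\tau=\tau\setminus\{x\}$ for some $x\in\tau$. Regarding the parenthetical identification: $\Delta_{A_m}$ denotes the complex of antichains in the root poset of type $A_m$, i.e. in $\{e_i-e_j : 1\le i<j\le m+1\}$ ordered by $e_i-e_j\le e_{i'}-e_{j'}$ iff $i'\le i<j\le j'$; antichains in this poset correspond bijectively to classical Dyck paths of semilength $m+1$.
   Formalization: The parenthetical isomorphism is stated with Δ_{A_{n-1}} in place of Δ_{A_n}: with Δ_{A_m} the antichain complex of the root poset of type A_m, the index n is off by one (at n=1 the Dyck complex is {∅}, but Δ_{A_1} has two faces). *)

theory Defs
  imports Main
begin

section \<open>Rational Dyck paths and their valley complex\<close>

datatype letter = U | D

definition ups :: "letter list \<Rightarrow> nat \<Rightarrow> nat" where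
  "ups w i = count_list (take i w) U"

definition downs :: "letter list \<Rightarrow> nat \<Rightarrow> nat" where
  "downs w i = count_list (take i w) D"

definition dyck_path :: "nat \<Rightarrow> nat \<Rightarrow> letter list \<Rightarrow> bool" where
  "dyck_path a b w \<longleftrightarrow>
     (\<forall>i. 1 \<le> i \<and> i < length w \<longrightarrow> b * downs w i \<le> a * ups w i) \<and>
     b * downs w (length w) = a * ups w (length w)"

definition has_semilength :: "nat \<Rightarrow> nat \<Rightarrow> letter list \<Rightarrow> nat \<Rightarrow> bool" where
  "has_semilength a b w n \<longleftrightarrow>
     ups w (length w) = n * b \<and> downs w (length w) = n * a \<and> length w = n * (a + b)"

lemma dyck_path_semilength_unique:
  assumes "a > 0" "b > 0" "coprime a b" "dyck_path a b w"
  shows "\<exists>!n. has_semilength a b w n"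
proof -
  have len: "length w = ups w (length w) + downs w (length w)"
  proof -
    have "length v = count_list v U + count_list v D" for v
    proof (induction v)
      case (Cons x v)
      then show ?case by (cases x) auto
    qed simp
    then show ?thesis by (simp add: ups_def downs_def)
  qed
  have eq: "b * downs w (length w) = a * ups w (length w)"
    using assms(4) by (simp add: dyck_path_def)
  then have "b dvd a * ups w (length w)"
    by (metis dvd_triv_left)
  then have "b dvd ups w (length w)"
    using assms(3) by (simp add: coprime_commute coprime_dvd_mult_right_iff)
  then obtain n where n: "ups w (length w) = n * b"
    by (metis dvd_def mult.commute)
  with eq have "b * downs w (length w) = b * (n * a)"
    by (simp add: ac_simps)
  with assms(2) have d: "downs w (length w) = n * a"
    by simp
  have "has_semilength a b w n"
    using len n d by (simp add: has_semilength_def algebra_simps)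
  moreover have "m = n" if "has_semilength a b w m" for m
    using that n assms(2) by (simp add: has_semilength_def)
  ultimately show ?thesis by blast
qed

definition Dyck :: "nat \<Rightarrow> nat \<Rightarrow> nat \<Rightarrow> letter list set" where
  "Dyck a b n = {w. dyck_path a b w \<and> has_semilength a b w n}"

text \<open>Letters are numbered from 1 in \<open>valley\<close>, so the \<open>i\<close>-th letter is \<open>w ! (i - 1)\<close>.\<close>

definition valley :: "letter list \<Rightarrow> nat \<Rightarrow> bool" where
  "valley w i \<longleftrightarrow> 1 \<le> i \<and> i < length w \<and> w ! (i - 1) = D \<and> w ! i = U"

definition valley_set :: "letter list \<Rightarrow> (int \<times> int) set" where
  "valley_set w = {(int i, int (ups w i) - int (downs w i)) | i. valley w i}"

definition Delta_Dyck :: "nat \<Rightarrow> nat \<Rightarrow> nat \<Rightarrow> (int \<times> int) set set" where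
  "Delta_Dyck a b n = valley_set ` Dyck a b n"


section \<open>Abstract simplicial complexes\<close>

text \<open>Complexes contain the empty face; the complex whose only face is empty is allowed.\<close>

definition finite_simplicial_complex :: "'v set set \<Rightarrow> bool" where
  "finite_simplicial_complex \<Delta> \<longleftrightarrow>
     finite \<Delta> \<and> (\<forall>\<sigma>\<in>\<Delta>. finite \<sigma>) \<and> {} \<in> \<Delta> \<and> (\<forall>\<sigma>\<in>\<Delta>. \<forall>\<tau>. \<tau> \<subseteq> \<sigma> \<longrightarrow> \<tau> \<in> \<Delta>)"

definition facets :: "'v set set \<Rightarrow> 'v set set" where
  "facets \<Delta> = {\<sigma> \<in> \<Delta>. \<forall>\<tau>\<in>\<Delta>. \<sigma> \<subseteq> \<tau> \<longrightarrow> \<tau> = \<sigma>}"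

definition shellable :: "'v set set \<Rightarrow> bool" where
  "shellable \<Delta> \<longleftrightarrow>
     (\<exists>r. strict_linear_order_on (facets \<Delta>) r \<and>
        (\<forall>\<sigma>\<in>facets \<Delta>. \<forall>\<tau>\<in>facets \<Delta>. (\<sigma>, \<tau>) \<in> r \<longrightarrow>
           (\<exists>\<gamma>\<in>facets \<Delta>. (\<gamma>, \<tau>) \<in> r \<and>
              (\<exists>x\<in>\<tau>. \<sigma> \<inter> \<tau> \<subseteq> \<gamma> \<inter> \<tau> \<and> \<gamma> \<inter> \<tau> = \<tau> - {x}))))"

definition complex_isomorphic :: "'v set set \<Rightarrow> 'w set set \<Rightarrow> bool" where
  "complex_isomorphic \<Delta> \<Gamma> \<longleftrightarrow>
     (\<exists>f. bij_betw f (\<Union>\<Delta>) (\<Union>\<Gamma>) \<and> (\<forall>\<sigma>. \<sigma> \<subseteq> \<Union>\<Delta> \<longrightarrow> (\<sigma> \<in> \<Delta> \<longleftrightarrow> f ` \<sigma> \<in> \<Gamma>)))"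


section \<open>Antichains in the root poset of type A\<close>

text \<open>The vector \<open>e\<^sub>i - e\<^sub>j\<close>, with vectors as integer functions on coordinates.\<close>

definition root :: "nat \<Rightarrow> nat \<Rightarrow> nat \<Rightarrow> int" where
  "root i j = (\<lambda>k. (if k = i then 1 else 0) - (if k = j then 1 else 0))"

text \<open>For \<open>m = 0\<close> there are no roots.\<close>

definition roots_A :: "nat \<Rightarrow> (nat \<Rightarrow> int) set" where
  "roots_A m = {root i j | i j. 1 \<le> i \<and> i < j \<and> j \<le> m + 1}"

text \<open>The indices in \<open>root_le\<close> are determined by the vectors, since \<open>i < j\<close> and \<open>i' < j'\<close>.\<close>

definition root_le :: "(nat \<Rightarrow> int) \<Rightarrow> (nat \<Rightarrow> int) \<Rightarrow> bool" where
  "root_le x y \<longleftrightarrow>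
     (\<exists>i j i' j'. x = root i j \<and> y = root i' j' \<and> i' \<le> i \<and> i < j \<and> j \<le> j')"

definition Delta_A :: "nat \<Rightarrow> (nat \<Rightarrow> int) set set" where
  "Delta_A m = {A. A \<subseteq> roots_A m \<and> pairwise (\<lambda>x y. \<not> root_le x y) A}"

end

theory Submission
  imports Defs "HOL-Library.Product_Lexorder"
begin

text \<open>
  Writing a valley as the pair \<open>(u, d)\<close> of numbers of up and down steps before it, the valley sets
  of rational Dyck paths are exactly the finite sets of points in the region
  \<open>1 \<le> d\<close>, \<open>u < n b\<close>, \<open>b d \<le> a u\<close> any two of which are strictly comparable in both coordinates.
  The facets of such a complex are shelled by the order in which \<open>S\<close> precedes \<open>T\<close> if the
  lexicographically least point \<open>x\<close> of their symmetric difference lies in \<open>S\<close>: if \<open>y\<close> is the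
  first point of \<open>T\<close> after \<open>x\<close>, then by maximality \<open>x\<close> and \<open>y\<close> are not strictly comparable, so the
  componentwise minimum \<open>c\<close> of \<open>x\<close> and \<open>y\<close> shares a coordinate with \<open>y\<close>, lies in the region, and
  may replace \<open>y\<close> in \<open>T\<close>; any facet containing the resulting chain precedes \<open>T\<close>.
\<close>

section \<open>Chain complexes of planar point sets\<close>

text \<open>The coordinates are parameters so that points can remain index-height pairs, with
  \<open>up2\<close> and \<open>down2\<close> as coordinates; doubling does not change strict
  comparability.\<close>

definition strictly_comparable :: "('v \<Rightarrow> int) \<Rightarrow> ('v \<Rightarrow> int) \<Rightarrow> 'v \<Rightarrow> 'v \<Rightarrow> bool" where
  "strictly_comparable u d x y \<longleftrightarrow> u x < u y \<and> d x < d y \<or> u y < u x \<and> d y < d x"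

definition chain_complex :: "('v \<Rightarrow> int) \<Rightarrow> ('v \<Rightarrow> int) \<Rightarrow> 'v set \<Rightarrow> 'v set set" where
  "chain_complex u d R = {S. S \<subseteq> R \<and> pairwise (strictly_comparable u d) S}"

text \<open>Subsets are compared as characteristic vectors read in increasing \<open>k\<close>,
  membership ranking before absence. Points sharing the key of \<open>x\<close> are unconstrained,
  hence the use with \<open>k\<close> injective on \<open>R\<close>.\<close>

definition lex_rel :: "('v \<Rightarrow> 'k::linorder) \<Rightarrow> 'v set \<Rightarrow> ('v set \<times> 'v set) set" where
  "lex_rel k R = {(S, T). S \<subseteq> R \<and> T \<subseteq> R \<and>
     (\<exists>x\<in>S - T. \<forall>y\<in>R. k y < k x \<longrightarrow> (y \<in> S \<longleftrightarrow> y \<in> T))}"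

lemma finite_simplicial_complex_chain_complex:
  assumes "finite R"
  shows "finite_simplicial_complex (chain_complex u d R)"
proof -
  have "chain_complex u d R \<subseteq> Pow R"
    by (auto simp: chain_complex_def)
  then show ?thesis
    using assms unfolding finite_simplicial_complex_def
    by (auto simp: chain_complex_def intro: finite_subset pairwise_subset)
qed

lemma strict_linear_order_on_lex_rel:
  assumes "finite R" "inj_on k R"
  shows "strict_linear_order_on (Pow R) (lex_rel k R)"
  unfolding strict_linear_order_on_def
proof (intro conjI)
  show "trans (lex_rel k R)"
  proof (rule transI)
    fix S T W
    assume "(S, T) \<in> lex_rel k R" "(T, W) \<in> lex_rel k R"
    then obtain x y where sub: "S \<subseteq> R" "T \<subseteq> R" "W \<subseteq> R"
      and x: "x \<in> S" "x \<notin> T" "\<And>z. z \<in> R \<Longrightarrow> k z < k x \<Longrightarrow> z \<in> S \<longleftrightarrow> z \<in> T"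
      and y: "y \<in> T" "y \<notin> W" "\<And>z. z \<in> R \<Longrightarrow> k z < k y \<Longrightarrow> z \<in> T \<longleftrightarrow> z \<in> W"
      unfolding lex_rel_def by blast
    \<comment> \<open>\<open>x\<close> is outside \<open>T\<close> and \<open>y\<close> inside;
      whichever has the smaller key separates \<open>S\<close> from \<open>W\<close>.\<close>
    have "k x \<noteq> k y"
      using x y sub assms(2) by (metis inj_onD subsetD)
    then consider "k x < k y" | "k y < k x"
      by (meson neqE)
    then have "\<exists>z\<in>S - W. \<forall>v\<in>R. k v < k z \<longrightarrow> (v \<in> S \<longleftrightarrow> v \<in> W)"
    proof cases
      case 1
      then show ?thesis
        using x y sub by (intro bexI[of _ x]) (auto dest: less_trans)
    next
      case 2
      then show ?thesis
        using x y sub by (intro bexI[of _ y]) (auto dest: less_trans)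
    qed
    with sub show "(S, W) \<in> lex_rel k R"
      by (auto simp: lex_rel_def)
  qed
  show "irrefl (lex_rel k R)"
    by (auto simp: irrefl_def lex_rel_def)
  show "total_on (Pow R) (lex_rel k R)"
  proof (rule total_onI)
    fix S T
    assume ST: "S \<in> Pow R" "T \<in> Pow R" "S \<noteq> T"
    define E where "E = (S - T) \<union> (T - S)"
    have E: "finite E" "E \<noteq> {}"
      using ST assms(1) by (auto simp: E_def intro: finite_subset)
    then obtain x where x: "x \<in> E" "\<And>y. y \<in> E \<Longrightarrow> \<not> k y < k x"
      using arg_min_if_finite[OF E, of k] by blast
    then have "\<forall>y\<in>R. k y < k x \<longrightarrow> (y \<in> S \<longleftrightarrow> y \<in> T)"
      by (auto simp: E_def)
    with x(1) ST show "(S, T) \<in> lex_rel k R \<or> (T, S) \<in> lex_rel k R"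
      by (auto simp: lex_rel_def E_def)
  qed
qed

lemma chain_complex_subset_facet:
  assumes "finite R" "S \<in> chain_complex u d R"
  obtains F where "F \<in> facets (chain_complex u d R)" "S \<subseteq> F"
proof -
  have "finite (chain_complex u d R)"
    using finite_simplicial_complex_chain_complex[OF assms(1)]
    by (simp add: finite_simplicial_complex_def)
  from finite_has_maximal2[OF this assms(2)] that show thesis
    by (auto simp: facets_def)
qed

lemma facet_insert_chain:
  assumes "F \<in> facets (chain_complex u d R)" "x \<in> R"
    and "\<And>y. y \<in> F \<Longrightarrow> y \<noteq> x \<Longrightarrow> strictly_comparable u d x y"
  shows "x \<in> F"
proof -
  have "insert x F \<in> chain_complex u d R"
    using assms by (auto simp: facets_def chain_complex_def pairwise_insert strictly_comparable_def)
  with assms(1) show ?thesis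
    by (auto simp: facets_def)
qed

text \<open>The assumption \<open>closed\<close> supplies the replacement corner: the second
  coordinate of a point of \<open>R\<close> may drop to any smaller value that \<open>d\<close>
  attains on \<open>R\<close>, the first being kept. Keys are compared by \<open>u\<close> first,
  then by \<open>d\<close>.\<close>

lemma shellable_chain_complex:
  fixes u d :: "'v \<Rightarrow> int"
  assumes fin: "finite R" and inj: "inj_on (\<lambda>x. (u x, d x)) R"
    and closed: "\<And>x y. \<lbrakk>x \<in> R; y \<in> R; d y \<le> d x\<rbrakk> \<Longrightarrow> \<exists>c\<in>R. u c = u x \<and> d c = d y"
  shows "shellable (chain_complex u d R)"
proof -
  let ?k = "\<lambda>x. (u x, d x)" and ?C = "chain_complex u d R"
  let ?r = "lex_rel ?k R"
  have sub: "facets ?C \<subseteq> Pow R"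
    by (auto simp: facets_def chain_complex_def)
  have order: "strict_linear_order_on (facets ?C) ?r"
    using strict_linear_order_on_lex_rel[OF fin inj] sub
    unfolding strict_linear_order_on_def by (auto intro: total_on_subset)
  have step: "\<exists>\<gamma>\<in>facets ?C. (\<gamma>, T) \<in> ?r \<and>
      (\<exists>y\<in>T. S \<inter> T \<subseteq> \<gamma> \<inter> T \<and> \<gamma> \<inter> T = T - {y})"
    if S: "S \<in> facets ?C" and T: "T \<in> facets ?C" and less: "(S, T) \<in> ?r" for S T
  proof -
    from less obtain x where x: "x \<in> S" "x \<notin> T"
      and agree: "\<And>y. y \<in> R \<Longrightarrow> ?k y < ?k x \<Longrightarrow> y \<in> S \<longleftrightarrow> y \<in> T"
      unfolding lex_rel_def by blast
    have SR: "S \<subseteq> R" and TR: "T \<subseteq> R"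
      using S T sub by auto
    have Sc: "\<And>v w. \<lbrakk>v \<in> S; w \<in> S; v \<noteq> w\<rbrakk> \<Longrightarrow> strictly_comparable u d v w"
      and Tc: "\<And>v w. \<lbrakk>v \<in> T; w \<in> T; v \<noteq> w\<rbrakk> \<Longrightarrow> strictly_comparable u d v w"
      using S T by (auto simp: facets_def chain_complex_def pairwise_def)
    have xR: "x \<in> R"
      using x SR by auto
    \<comment> \<open>Points of \<open>T\<close> before \<open>x\<close> also lie in
      \<open>S\<close> by agreement, and \<open>S\<close> is a chain containing
      \<open>x\<close>.\<close>
    have below: "u t < u x \<and> d t < d x" if "t \<in> T" "?k t < ?k x" for t
    proof -
      have "t \<in> S" "t \<noteq> x"
        using that agree[of t] x TR by auto
      then have "strictly_comparable u d t x"
        using Sc x by blast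
      then show ?thesis
        using that(2) by (auto simp: strictly_comparable_def)
    qed
    have above: "?k x < ?k t" if "t \<in> T" "\<not> ?k t < ?k x" for t
      using that x TR xR inj_onD[OF inj, of t x] by (metis neqE subsetD)
    define A where "A = {t \<in> T. ?k x < ?k t}"
    \<comment> \<open>Without later points, \<open>x\<close> would lie strictly above all of
      \<open>T\<close> and could be added to the facet \<open>T\<close>.\<close>
    have "A \<noteq> {}"
    proof
      assume "A = {}"
      then have "strictly_comparable u d x t" if "t \<in> T" for t
        using that below[of t] above[of t] by (auto simp: A_def strictly_comparable_def)
      then show False
        using facet_insert_chain[OF T xR] x by blast
    qed
    moreover have "finite A"
      using TR fin by (auto simp: A_def intro: finite_subset)
    ultimately obtain y where y: "y \<in> A" and ymin: "\<And>t. t \<in> A \<Longrightarrow> \<not> ?k t < ?k y"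
      using arg_min_if_finite[of A ?k] by blast
    have yT: "y \<in> T" and yx: "?k x < ?k y" and yR: "y \<in> R"
      using y TR by (auto simp: A_def)
    have later: "u y < u t \<and> d y < d t" if "t \<in> A" "t \<noteq> y" for t
      using that ymin[of t] Tc[of t y] yT by (auto simp: A_def strictly_comparable_def)
    have earlier: "u t < u x \<and> d t < d x \<and> u t < u y \<and> d t < d y" if "t \<in> T" "t \<notin> A" for t
    proof -
      have "?k t < ?k x"
        using that above[of t] by (auto simp: A_def)
      then have "?k t < ?k y"
        using yx by (rule less_trans)
      moreover from this have "strictly_comparable u d t y"
        using Tc[of t y] that(1) yT by auto
      ultimately show ?thesis
        using below[OF that(1) \<open>?k t < ?k x\<close>] by (auto simp: strictly_comparable_def)
    qed
    \<comment> \<open>Otherwise \<open>x\<close> fits strictly between the earlier points of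
      \<open>T\<close> and \<open>y\<close>, against maximality of \<open>T\<close>.\<close>
    have incomp: "\<not> (u x < u y \<and> d x < d y)"
    proof
      assume xy: "u x < u y \<and> d x < d y"
      have "strictly_comparable u d x t" if "t \<in> T" for t
        using that later[of t] earlier[of t] xy
        by (cases "t \<in> A"; cases "t = y") (auto simp: strictly_comparable_def)
      then show False
        using facet_insert_chain[OF T xR] x by blast
    qed
    \<comment> \<open>This puts \<open>S \<inter> T\<close> inside \<open>T - {y}\<close>. In the
      chain \<open>S\<close>, lexicographic order would make \<open>x\<close> strictly below
      \<open>y\<close>.\<close>
    have yS: "y \<notin> S"
      using incomp Sc[OF x(1), of y] x(2) yT yx
      by (cases "x = y") (auto simp: strictly_comparable_def)
    \<comment> \<open>As \<open>u x \<le> u y\<close>, this is the componentwise minimum of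
      \<open>x\<close> and \<open>y\<close>.\<close>
    obtain c where c: "c \<in> R" "u c = u x" "d c = min (d x) (d y)"
      using closed[OF xR, of x] closed[OF xR yR] xR by (metis min_def order.refl linear)
    \<comment> \<open>By \<open>incomp\<close>, either \<open>u x = u y\<close> or
      \<open>d y \<le> d x\<close>, so \<open>c\<close> shares a coordinate with
      \<open>y\<close>.\<close>
    have cy: "?k c < ?k y" "u c \<le> u y" "d c \<le> d y" "\<not> strictly_comparable u d c y"
      using c yx incomp by (auto simp: strictly_comparable_def)
    \<comment> \<open>Earlier points lie strictly below both \<open>x\<close> and \<open>y\<close>,
      hence below \<open>c\<close>; later ones lie strictly above \<open>y\<close>, which dominates
      \<open>c\<close>.\<close>
    have cT: "strictly_comparable u d c t" if "t \<in> T" "t \<noteq> y" for t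
      using that later[of t] earlier[of t] c cy
      by (cases "t \<in> A") (auto simp: strictly_comparable_def)
    have "insert c (T - {y}) \<in> ?C"
      using T c(1) cT
      by (auto simp: facets_def chain_complex_def pairwise_def strictly_comparable_def)
    then obtain G where G: "G \<in> facets ?C" "insert c (T - {y}) \<subseteq> G"
      using chain_complex_subset_facet[OF fin] by metis
    have yG: "y \<notin> G"
      using G cy(1,4) by (auto simp: facets_def chain_complex_def pairwise_def)
    \<comment> \<open>\<open>G\<close> may contain further points, so the reverse order is excluded
      instead of locating the first difference. A witness could only be \<open>y\<close>, and then
      \<open>c\<close>, having a smaller key, would lie in \<open>T\<close>.\<close>
    have "(T, G) \<notin> ?r"
    proof
      assume "(T, G) \<in> ?r"
      then obtain z where "z \<in> T - G" and z: "\<forall>v\<in>R. ?k v < ?k z \<longrightarrow> (v \<in> T \<longleftrightarrow> v \<in> G)"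
        unfolding lex_rel_def by blast
      then have "z = y"
        using G(2) by auto
      then have "c \<in> T"
        using z c(1) cy(1) G(2) by blast
      then show False
        using Tc[of c y] yT cy by auto
    qed
    moreover have "T \<noteq> G"
      using yT yG by auto
    ultimately have "(G, T) \<in> ?r"
      using order G(1) T by (auto simp: strict_linear_order_on_def total_on_def)
    moreover have "G \<inter> T = T - {y}"
      using G(2) yG by auto
    ultimately show ?thesis
      using G(1) yT yS by (intro bexI[of _ G]) auto
  qed
  show ?thesis
    unfolding shellable_def using order step by (intro exI[of _ ?r]) auto
qed

section \<open>Valley sets of rational Dyck paths\<close>

definition position :: "nat \<Rightarrow> nat \<Rightarrow> int \<times> int" where
  "position u d = (int u + int d, int u - int d)"

text \<open>The bound \<open>1 \<le> d\<close> reflects the \<open>D\<close> just before a valley,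
  \<open>u < n * b\<close> the \<open>U\<close> just after it.\<close>

definition valley_points :: "nat \<Rightarrow> nat \<Rightarrow> nat \<Rightarrow> (int \<times> int) set" where
  "valley_points a b n = {position u d | u d. 1 \<le> d \<and> u < n * b \<and> b * d \<le> a * u}"

text \<open>Twice the numbers of up and down steps before a position.\<close>

definition up2 :: "int \<times> int \<Rightarrow> int" where "up2 p = fst p + snd p"

definition down2 :: "int \<times> int \<Rightarrow> int" where "down2 p = fst p - snd p"

lemma up2_position [simp]: "up2 (position u d) = 2 * int u"
  and down2_position [simp]: "down2 (position u d) = 2 * int d"
  by (simp_all add: up2_def down2_def position_def)

lemma position_eq_iff [simp]: "position u d = position u' d' \<longleftrightarrow> u = u' \<and> d = d'"
  by (auto simp: position_def)

lemma finite_valley_points: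
  assumes "b > 0"
  shows "finite (valley_points a b n)"
proof (rule finite_subset)
  show "valley_points a b n \<subseteq> case_prod position ` ({..<n * b} \<times> {..a * (n * b)})"
  proof
    fix p assume "p \<in> valley_points a b n"
    then obtain u d where p: "p = position u d" "u < n * b" "b * d \<le> a * u"
      by (auto simp: valley_points_def)
    have "d \<le> b * d"
      using assms by simp
    also have "\<dots> \<le> a * u"
      by (rule p)
    also have "\<dots> \<le> a * (n * b)"
      using p by (intro mult_left_mono) auto
    finally show "p \<in> case_prod position ` ({..<n * b} \<times> {..a * (n * b)})"
      using p by force
  qed
qed simp

section \<open>Letter counts and the valleys of a given path\<close>

lemma ups_mono: "i \<le> j \<Longrightarrow> ups w i \<le> ups w j"
  and downs_mono: "i \<le> j \<Longrightarrow> downs w i \<le> downs w j"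
  by (auto simp: ups_def downs_def le_iff_add take_add)

lemma ups_Suc: "i < length w \<Longrightarrow> ups w (Suc i) = ups w i + (if w ! i = U then 1 else 0)"
  and downs_Suc: "i < length w \<Longrightarrow> downs w (Suc i) = downs w i + (if w ! i = D then 1 else 0)"
  by (auto simp: ups_def downs_def take_Suc_conv_app_nth)

lemma length_eq_count_letters: "length w = count_list w U + count_list w D"
proof (induction w)
  case (Cons x w)
  then show ?case by (cases x) auto
qed simp

lemma count_list_replicate: "count_list (replicate k x) y = (if x = y then k else 0)"
  by (induction k) auto

lemma valley_set_position: "valley_set w = {position (ups w i) (downs w i) | i. valley w i}"
proof -
  have "int i = int (ups w i) + int (downs w i)" if "valley w i" for i
    using that length_eq_count_letters[of "take i w"] by (simp add: ups_def downs_def valley_def)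
  then have "(\<lambda>i. (int i, int (ups w i) - int (downs w i))) ` {i. valley w i} =
      (\<lambda>i. position (ups w i) (downs w i)) ` {i. valley w i}"
    by (intro image_cong) (auto simp: position_def)
  then show ?thesis
    by (simp add: valley_set_def setcompr_eq_image)
qed

text \<open>The \<open>U\<close> just after \<open>i\<close> is among the first \<open>j\<close>
  letters, and the \<open>D\<close> just before \<open>j\<close> lies beyond the first
  \<open>i\<close>, so both counts grow.\<close>

lemma valley_less:
  assumes "valley w i" "valley w j" "i < j"
  shows "ups w i < ups w j" "downs w i < downs w j"
proof -
  have "ups w i < ups w (Suc i)"
    using assms by (simp add: ups_Suc valley_def)
  then show "ups w i < ups w j"
    using assms(3) ups_mono[of "Suc i" j w] by simp
  obtain k where k: "j = Suc k"
    using assms(3) by (cases j) auto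
  then have "downs w k < downs w j"
    using assms(2) by (simp add: downs_Suc valley_def)
  moreover have "downs w i \<le> downs w k"
    using assms(3) k by (intro downs_mono) simp
  ultimately show "downs w i < downs w j"
    by simp
qed

lemma valley_set_in_chain_complex:
  assumes "w \<in> Dyck a b n"
  shows "valley_set w \<in> chain_complex up2 down2 (valley_points a b n)"
proof -
  have "position (ups w i) (downs w i) \<in> valley_points a b n" if i: "valley w i" for i
  proof -
    obtain k where k: "i = Suc k"
      using i by (cases i) (auto simp: valley_def)
    then have "ups w i < ups w (Suc i)" "downs w k < downs w i"
      using i by (auto simp: ups_Suc downs_Suc valley_def)
    moreover have "ups w (Suc i) \<le> ups w (length w)"
      using that by (intro ups_mono) (simp add: valley_def)
    ultimately have "ups w i < n * b" "1 \<le> downs w i"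
      using assms that by (auto simp: Dyck_def has_semilength_def valley_def)
    moreover have "b * downs w i \<le> a * ups w i"
      using assms that by (auto simp: Dyck_def dyck_path_def valley_def)
    ultimately show ?thesis
      by (auto simp: valley_points_def)
  qed
  moreover have "strictly_comparable up2 down2
      (position (ups w i) (downs w i)) (position (ups w j) (downs w j))"
    if "valley w i" "valley w j" "i \<noteq> j" for i j
    using that valley_less[of w i j] valley_less[of w j i]
    by (cases "i < j") (auto simp: strictly_comparable_def)
  ultimately show ?thesis
    unfolding chain_complex_def valley_set_position pairwise_def by blast
qed

section \<open>Construction of a path with prescribed valleys\<close>

definition dyck_prefix :: "nat \<Rightarrow> nat \<Rightarrow> letter list \<Rightarrow> bool" where
  "dyck_prefix a b w \<longleftrightarrow> (\<forall>i\<le>length w. b * downs w i \<le> a * ups w i)"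

text \<open>The bound in \<open>dyck_prefix\<close> covers the full length and demands no final
  equality, so paths can be built letter by letter.\<close>

lemma dyck_prefix_snoc:
  "dyck_prefix a b (w @ [x]) \<longleftrightarrow>
     dyck_prefix a b w \<and> b * count_list (w @ [x]) D \<le> a * count_list (w @ [x]) U"
  unfolding dyck_prefix_def ups_def downs_def
  by (auto simp: le_Suc_eq all_conj_distrib simp del: count_list_append)

text \<open>A new last letter can create a valley only at the junction, whose position is given by
  the counts of all of \<open>w\<close>.\<close>

lemma valley_set_snoc:
  "valley_set (w @ [x]) = valley_set w \<union>
     (if x = U \<and> w \<noteq> [] \<and> last w = D then {position (count_list w U) (count_list w D)} else {})"
proof -
  have "valley (w @ [x]) i \<longleftrightarrow>
      valley w i \<or> i = length w \<and> x = U \<and> w \<noteq> [] \<and> last w = D" for i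
    by (cases w rule: rev_cases) (auto simp: valley_def nth_append last_conv_nth)
  then have "{i. valley (w @ [x]) i} = {i. valley w i} \<union>
        (if x = U \<and> w \<noteq> [] \<and> last w = D then {length w} else {})"
    and "\<And>v. valley_set v = (\<lambda>i. position (ups v i) (downs v i)) ` {i. valley v i}"
    by (auto simp: valley_set_position)
  moreover have "(\<lambda>i. position (ups (w @ [x]) i) (downs (w @ [x]) i)) ` {i. valley w i} =
      (\<lambda>i. position (ups w i) (downs w i)) ` {i. valley w i}"
    by (intro image_cong) (auto simp: ups_def downs_def valley_def)
  moreover have "ups (w @ [x]) (length w) = count_list w U"
    "downs (w @ [x]) (length w) = count_list w D"
    by (simp_all add: ups_def downs_def)
  ultimately show ?thesis
    by (auto simp: image_Un)
qed

text \<open>Only the first \<open>U\<close> of the block follows a \<open>D\<close>, so one valley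
  arises; \<open>Suc p\<close> ensures that this \<open>U\<close> is present.\<close>

lemma append_replicate_U:
  assumes "dyck_prefix a b w" "w \<noteq> [] \<Longrightarrow> last w = D"
  shows "dyck_prefix a b (w @ replicate (Suc p) U) \<and>
    valley_set (w @ replicate (Suc p) U) = valley_set w \<union>
      (if w = [] then {} else {position (count_list w U) (count_list w D)})"
proof (induction p)
  case 0
  have "b * count_list w D \<le> a * count_list w U"
    using assms(1) by (auto simp: dyck_prefix_def ups_def downs_def dest: spec[of _ "length w"])
  with assms show ?case
    by (auto simp: dyck_prefix_snoc valley_set_snoc)
next
  case (Suc p)
  let ?v = "w @ replicate (Suc p) U"
  have v: "w @ replicate (Suc (Suc p)) U = ?v @ [U]"
    by (simp add: replicate_append_same)
  have "b * count_list ?v D \<le> a * count_list ?v U"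
    using Suc unfolding dyck_prefix_def ups_def downs_def
    by (auto simp del: replicate_Suc dest: spec[of _ "length ?v"])
  with Suc show ?case
    unfolding v dyck_prefix_snoc valley_set_snoc by (auto simp: last_append)
qed

text \<open>A block of \<open>D\<close> creates no valley, and the slope bound is tightest at its
  end.\<close>

lemma append_replicate_D:
  assumes "dyck_prefix a b w" "b * (count_list w D + q) \<le> a * count_list w U"
  shows "dyck_prefix a b (w @ replicate q D) \<and> valley_set (w @ replicate q D) = valley_set w"
  using assms(2)
proof (induction q)
  case (Suc q)
  have v: "w @ replicate (Suc q) D = (w @ replicate q D) @ [D]"
    by (simp add: replicate_append_same)
  with Suc show ?case
    unfolding v dyck_prefix_snoc valley_set_snoc by (auto simp: count_list_replicate)
qed (use assms(1) in simp)

text \<open>The end point \<open>(N, M)\<close> varies so that the top point of the chain can become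
  the end of a shorter path. Ending in \<open>D\<close> lets the next block of \<open>U\<close> turn
  that end into a valley.\<close>

lemma chain_realizable:
  assumes "finite S" "pairwise (strictly_comparable up2 down2) S"
    and "\<And>p. p \<in> S \<Longrightarrow> \<exists>u d. p = position u d \<and> 1 \<le> u \<and> 1 \<le> d \<and> u < N \<and> d < M \<and> b * d \<le> a * u"
    and "b * M \<le> a * N" "1 \<le> N" "1 \<le> M"
  shows "\<exists>w. valley_set w = S \<and> dyck_prefix a b w \<and> w \<noteq> [] \<and> last w = D \<and>
    count_list w U = N \<and> count_list w D = M"
  using assms
proof (induction "card S" arbitrary: S N M)
  case 0
  then have S: "S = {}"
    by simp
  obtain N' M' where NM: "N = Suc N'" "M = Suc M'"
    using 0 by (metis One_nat_def Suc_le_D)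
  have nil: "dyck_prefix a b []" "valley_set [] = {}"
    by (auto simp: dyck_prefix_def ups_def downs_def valley_set_def valley_def)
  from append_replicate_U[OF nil(1), of N'] nil NM
  have "dyck_prefix a b (replicate N U)" "valley_set (replicate N U) = {}"
    by auto
  \<comment> \<open>All ups followed by all downs: a single peak and no valley.\<close>
  with append_replicate_D[of a b "replicate N U" M] 0 S show ?case
    by (intro exI[of _ "replicate N U @ replicate M D"]) (auto simp: count_list_replicate)
next
  case (Suc m)
  have "S \<noteq> {}"
    using Suc.hyps(2) by auto
  \<comment> \<open>In a chain, the point with most up steps exceeds all others strictly in both
    coordinates, so they satisfy the bounds for the end point \<open>(u, d)\<close>.\<close>
  then obtain p where p: "p \<in> S" "\<And>q. q \<in> S \<Longrightarrow> up2 q \<le> up2 p"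
    using Suc.prems(1) Max_in[of "up2 ` S"] Max_ge[of "up2 ` S"] by fastforce
  then obtain u d where ud: "p = position u d" "1 \<le> u" "1 \<le> d" "u < N" "d < M" "b * d \<le> a * u"
    using Suc.prems(3) by blast
  have "\<exists>w. valley_set w = S - {p} \<and> dyck_prefix a b w \<and> w \<noteq> [] \<and> last w = D \<and>
    count_list w U = u \<and> count_list w D = d"
  proof (rule Suc.hyps(1))
    show "m = card (S - {p})"
      using Suc.hyps(2) Suc.prems(1) p(1) by simp
    show "pairwise (strictly_comparable up2 down2) (S - {p})"
      using Suc.prems(2) by (rule pairwise_subset) auto
    fix q assume q: "q \<in> S - {p}"
    then obtain u' d' where "q = position u' d'" "1 \<le> u'" "1 \<le> d'" "b * d' \<le> a * u'"
      using Suc.prems(3)[of q] by auto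
    moreover have "strictly_comparable up2 down2 q p"
      using q p(1) Suc.prems(2) by (auto simp: pairwise_def)
    ultimately show "\<exists>u' d'. q = position u' d' \<and> 1 \<le> u' \<and> 1 \<le> d' \<and> u' < u \<and> d' < d \<and> b * d' \<le> a * u'"
      using p(2)[of q] q ud(1) by (auto simp: strictly_comparable_def)
  qed (use Suc.prems ud in auto)
  then obtain w where w: "valley_set w = S - {p}" "dyck_prefix a b w" "w \<noteq> []" "last w = D"
    "count_list w U = u" "count_list w D = d"
    by blast
  \<comment> \<open>Since \<open>u < N\<close>, at least one \<open>U\<close> follows the shorter
    path, which produces the valley \<open>p\<close>.\<close>
  obtain k where k: "N = u + Suc k"
    using ud(4) less_iff_Suc_add by auto
  define v where "v = w @ replicate (Suc k) U"
  have v: "dyck_prefix a b v" "valley_set v = S" "count_list v U = N" "count_list v D = d"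
    using append_replicate_U[OF w(2,4), of k] w p(1) ud(1) k unfolding v_def by (auto simp: count_list_replicate)
  with append_replicate_D[of a b v "M - d"] Suc.prems ud show ?case
    by (intro exI[of _ "v @ replicate (M - d) D"]) (auto simp: count_list_replicate)
qed

lemma Delta_Dyck_eq_chain_complex:
  assumes "a > 0" "b > 0" "n \<ge> 1"
  shows "Delta_Dyck a b n = chain_complex up2 down2 (valley_points a b n)"
proof
  show "Delta_Dyck a b n \<subseteq> chain_complex up2 down2 (valley_points a b n)"
    using valley_set_in_chain_complex by (auto simp: Delta_Dyck_def)
  show "chain_complex up2 down2 (valley_points a b n) \<subseteq> Delta_Dyck a b n"
  proof
    fix S assume S: "S \<in> chain_complex up2 down2 (valley_points a b n)"
    then have fin: "finite S"
      using finite_valley_points[OF assms(2)] by (auto simp: chain_complex_def intro: finite_subset)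
    have "\<exists>u d. p = position u d \<and> 1 \<le> u \<and> 1 \<le> d \<and> u < n * b \<and> d < n * a \<and> b * d \<le> a * u"
      if "p \<in> S" for p
    proof -
      obtain u d where ud: "p = position u d" "1 \<le> d" "u < n * b" "b * d \<le> a * u"
        using S \<open>p \<in> S\<close> by (auto simp: chain_complex_def valley_points_def)
      have "u \<noteq> 0"
        using ud assms(2) by (intro notI) auto
      \<comment> \<open>The bound on \<open>d\<close> comes from
        \<open>b * d \<le> a * u < a * (n * b)\<close> after cancelling \<open>b\<close>.\<close>
      moreover have "a * u < a * (n * b)"
        using ud(3) assms(1) by simp
      then have "b * d < b * (n * a)"
        using ud(4) by (metis le_less_trans mult.commute mult.left_commute)
      then have "d < n * a"
        by simp
      ultimately show ?thesis
        using ud by (auto simp: Suc_le_eq)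
    qed
    \<comment> \<open>The end point \<open>(n * b, n * a)\<close> satisfies the slope condition with
      equality, so the prefix is a full path.\<close>
    then obtain w where w: "valley_set w = S" "dyck_prefix a b w"
      "count_list w U = n * b" "count_list w D = n * a"
      using chain_realizable[OF fin, of "n * b" "n * a" b a] S assms
      by (auto simp: chain_complex_def ac_simps)
    have "w \<in> Dyck a b n"
      using w length_eq_count_letters[of w] by (auto simp: Dyck_def dyck_path_def has_semilength_def dyck_prefix_def ups_def
          downs_def algebra_simps)
    with w show "S \<in> Delta_Dyck a b n"
      by (auto simp: Delta_Dyck_def)
  qed
qed

section \<open>Shellability of the valley complex\<close>

lemma finite_shellable_Delta_Dyck:
  assumes "a > 0" "b > 0" "n \<ge> 1"
  shows "finite_simplicial_complex (Delta_Dyck a b n) \<and> shellable (Delta_Dyck a b n)"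
  unfolding Delta_Dyck_eq_chain_complex[OF assms]
proof
  have fin: "finite (valley_points a b n)"
    using assms by (intro finite_valley_points)
  then show "finite_simplicial_complex (chain_complex up2 down2 (valley_points a b n))"
    by (rule finite_simplicial_complex_chain_complex)
  show "shellable (chain_complex up2 down2 (valley_points a b n))"
  proof (rule shellable_chain_complex[OF fin])
    show "inj_on (\<lambda>p. (up2 p, down2 p)) (valley_points a b n)"
      by (rule inj_onI) (auto simp: up2_def down2_def)
    fix p q assume p: "p \<in> valley_points a b n" and q: "q \<in> valley_points a b n"
      and le: "down2 q \<le> down2 p"
    obtain u d where ud: "p = position u d" "u < n * b" "b * d \<le> a * u"
      using p by (auto simp: valley_points_def)
    obtain u' d' where ud': "q = position u' d'" "1 \<le> d'"
      using q by (auto simp: valley_points_def)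
    \<comment> \<open>Fewer down steps preserve the slope bound, which is the closure needed for
      shelling.\<close>
    have "b * d' \<le> b * d"
      using le ud ud' by simp
    then have "b * d' \<le> a * u"
      using ud(3) by (rule order_trans)
    then have "position u d' \<in> valley_points a b n"
      using ud ud' by (auto simp: valley_points_def)
    then show "\<exists>c\<in>valley_points a b n. up2 c = up2 p \<and> down2 c = down2 q"
      using ud ud' by (intro bexI[of _ "position u d'"]) auto
  qed
qed

section \<open>Antichains of roots\<close>

lemma root_eq_iff:
  assumes "i < j" "i' < j'"
  shows "root i j = root i' j' \<longleftrightarrow> i = i' \<and> j = j'"
proof
  assume "root i j = root i' j'"
  \<comment> \<open>For distinct indices the entry 1 occurs only at the first and -1 only at the
    second.\<close>
  then have "root i j i = root i' j' i" "root i j j = root i' j' j"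
    by simp_all
  then show "i = i' \<and> j = j'"
    using assms by (auto simp: root_def split: if_splits)
qed simp

lemma root_le_iff:
  assumes "i < j" "i' < j'"
  shows "root_le (root i j) (root i' j') \<longleftrightarrow> i' \<le> i \<and> j \<le> j'"
proof
  assume "root_le (root i j) (root i' j')"
  then obtain k l k' l' where kl: "root i j = root k l" "root i' j' = root k' l'"
    "k' \<le> k" "k < l" "l \<le> l'"
    unfolding root_le_def by blast
  then show "i' \<le> i \<and> j \<le> j'"
    using assms root_eq_iff[of i j k l] root_eq_iff[of i' j' k' l'] by simp
qed (use assms in \<open>auto simp: root_le_def\<close>)

text \<open>Division undoes the doubling. The shift \<open>Suc\<close> turns the region
  \<open>d \<le> u\<close> of the classical case into the index condition
  \<open>d < Suc u\<close>.\<close>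

definition root_of :: "int \<times> int \<Rightarrow> nat \<Rightarrow> int" where
  "root_of p = root (nat (down2 p div 2)) (Suc (nat (up2 p div 2)))"

lemma root_of_position [simp]: "root_of (position u d) = root d (Suc u)"
  by (simp add: root_of_def)

lemma Union_chain_complex: "\<Union>(chain_complex u d R) = R"
proof
  show "R \<subseteq> \<Union>(chain_complex u d R)"
  proof
    fix x assume "x \<in> R"
    then have "{x} \<in> chain_complex u d R"
      by (simp add: chain_complex_def)
    then show "x \<in> \<Union>(chain_complex u d R)"
      by blast
  qed
qed (auto simp: chain_complex_def)

lemma Union_Delta_A: "\<Union>(Delta_A m) = roots_A m"
proof
  show "roots_A m \<subseteq> \<Union>(Delta_A m)"
  proof
    fix x assume "x \<in> roots_A m"
    then have "{x} \<in> Delta_A m"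
      by (simp add: Delta_A_def)
    then show "x \<in> \<Union>(Delta_A m)"
      by blast
  qed
qed (auto simp: Delta_A_def)

text \<open>Semilength \<open>n\<close> corresponds to rank \<open>n - 1\<close>: root indices then
  run up to \<open>n\<close>, matching \<open>Suc u \<le> n\<close>.\<close>

lemma complex_isomorphic_Delta_A:
  assumes "n \<ge> 1"
  shows "complex_isomorphic (Delta_Dyck 1 1 n) (Delta_A (n - 1))"
proof -
  let ?R = "valley_points 1 1 n"
  have R: "?R = {position u d | u d. 1 \<le> d \<and> d \<le> u \<and> u < n}"
    by (auto simp: valley_points_def)
  have roots: "roots_A (n - 1) = {root d (Suc u) | u d. 1 \<le> d \<and> d \<le> u \<and> u < n}"
  proof -
    have "\<exists>u d'. root d j = root d' (Suc u) \<and> 1 \<le> d' \<and> d' \<le> u \<and> u < n"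
      if "1 \<le> d" "d < j" "j \<le> n" for d j
      using that by (intro exI[of _ "j - 1"] exI[of _ d]) auto
    then show ?thesis
      using assms unfolding roots_A_def by fastforce
  qed
  have inj: "inj_on root_of ?R"
  proof (rule inj_onI)
    fix p q assume "p \<in> ?R" "q \<in> ?R" and eq: "root_of p = root_of q"
    then obtain u d u' d' where "p = position u d" "d \<le> u" "q = position u' d'" "d' \<le> u'"
      unfolding R by blast
    then show "p = q"
      using eq by (simp add: root_eq_iff)
  qed
  have image: "root_of ` ?R = roots_A (n - 1)"
  proof (intro equalityI subsetI)
    fix x assume "x \<in> roots_A (n - 1)"
    then obtain u d where x: "x = root d (Suc u)" and "1 \<le> d" "d \<le> u" "u < n"
      unfolding roots by blast
    then have "position u d \<in> ?R"
      unfolding R by blast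
    then show "x \<in> root_of ` ?R"
      unfolding x by (rule rev_image_eqI) simp
  next
    fix x assume "x \<in> root_of ` ?R"
    then obtain u d where "x = root_of (position u d)" "1 \<le> d" "d \<le> u" "u < n"
      unfolding R by blast
    then show "x \<in> roots_A (n - 1)"
      unfolding roots by auto
  qed
  \<comment> \<open>One root lies below another when its \<open>d\<close> is at least as large and
    its \<open>u\<close> at most as large; neither direction holds exactly when both coordinates
    change strictly in the same sense.\<close>
  have comp: "strictly_comparable up2 down2 p q \<longleftrightarrow>
      \<not> root_le (root_of p) (root_of q) \<and> \<not> root_le (root_of q) (root_of p)"
    if "p \<in> ?R" "q \<in> ?R" for p q
  proof -
    from that obtain u d u' d' where "p = position u d" "d \<le> u" "q = position u' d'" "d' \<le> u'"
      unfolding R by blast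
    then show ?thesis
      by (auto simp: root_le_iff strictly_comparable_def)
  qed
  have "S \<in> chain_complex up2 down2 ?R \<longleftrightarrow> root_of ` S \<in> Delta_A (n - 1)" if S: "S \<subseteq> ?R" for S
  proof -
    have "pairwise (\<lambda>x y. \<not> root_le x y) (root_of ` S) \<longleftrightarrow>
        (\<forall>p\<in>S. \<forall>q\<in>S. p \<noteq> q \<longrightarrow> \<not> root_le (root_of p) (root_of q))"
      using inj_on_eq_iff[OF inj_on_subset[OF inj S]] by (auto simp: pairwise_def)
    \<comment> \<open>Quantifying over ordered pairs makes the one-sided condition on roots yield
      both sides of \<open>comp\<close>.\<close>
    also have "\<dots> \<longleftrightarrow> pairwise (strictly_comparable up2 down2) S"
    proof
      assume *: "\<forall>p\<in>S. \<forall>q\<in>S. p \<noteq> q \<longrightarrow> \<not> root_le (root_of p) (root_of q)"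
      show "pairwise (strictly_comparable up2 down2) S"
      proof (rule pairwiseI)
        fix p q assume "p \<in> S" "q \<in> S" "p \<noteq> q"
        with * comp[of p q] S show "strictly_comparable up2 down2 p q"
          by (metis subsetD)
      qed
    next
      assume *: "pairwise (strictly_comparable up2 down2) S"
      show "\<forall>p\<in>S. \<forall>q\<in>S. p \<noteq> q \<longrightarrow> \<not> root_le (root_of p) (root_of q)"
      proof (intro ballI impI)
        fix p q assume pq: "p \<in> S" "q \<in> S" "p \<noteq> q"
        then have "strictly_comparable up2 down2 p q"
          using * by (simp add: pairwise_def)
        with comp[of p q] pq S show "\<not> root_le (root_of p) (root_of q)"
          by blast
      qed
    qed
    finally have "pairwise (\<lambda>x y. \<not> root_le x y) (root_of ` S) \<longleftrightarrow>
        pairwise (strictly_comparable up2 down2) S" .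
    moreover have "root_of ` S \<subseteq> roots_A (n - 1)"
      using S unfolding image[symmetric] by (rule image_mono)
    ultimately show ?thesis
      using S unfolding chain_complex_def Delta_A_def by blast
  qed
  moreover have "bij_betw root_of ?R (roots_A (n - 1))"
    using inj image by (simp add: bij_betw_def)
  moreover have "Delta_Dyck 1 1 n = chain_complex up2 down2 ?R"
    using assms by (intro Delta_Dyck_eq_chain_complex) simp_all
  ultimately show ?thesis
    unfolding complex_isomorphic_def
    by (intro exI[of _ root_of]) (simp add: Union_chain_complex Union_Delta_A)
qed

theorem theorem1p2:
  fixes a b n :: nat
  assumes "a > 0" and "b > 0" and "coprime a b" and "n \<ge> 1"
  shows "(finite_simplicial_complex (Delta_Dyck a b n) \<and> shellable (Delta_Dyck a b n)) \<and>
    (finite_simplicial_complex (Delta_Dyck 1 1 n) \<and> shellable (Delta_Dyck 1 1 n) \<and>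
     complex_isomorphic (Delta_Dyck 1 1 n) (Delta_A (n - 1)))"
  using assms finite_shellable_Delta_Dyck[of a b n] finite_shellable_Delta_Dyck[of 1 1 n]
    complex_isomorphic_Delta_A[of n] by simp

end
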